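(* Let $f(x)=\prod_{k\geq0}(1-x^{3^k}-x^{2\cdot 3^k})$. Then $H_n(f)\neq0$ for every positive integer $n$.
   Context: For a power series $f=\sum a_ix^i$, $H_n(f)=\det(a_{i+j})_{0\le i,j\le n-1}$. *)

theory Defs
  imports
    "HOL-Analysis.Infinite_Products"
    "HOL-Computational_Algebra.Formal_Power_Series"
    "Jordan_Normal_Form.Determinant"
begin

definition hankel_det :: "nat \<Rightarrow> 'a::comm_ring_1 fps \<Rightarrow> 'a" where
  "hankel_det n f = Determinant.det (mat n n (\<lambda>(i, j). fps_nth f (i + j)))"

(* The library's infinite product "prodinf", taken in the X-adic topology on power series:
   the limit of the partial products over k <= n. *)
definition ternary_product :: "int fps" where
  "ternary_product = (\<Prod>k. 1 - fps_X ^ (3 ^ k) - fps_X ^ (2 * 3 ^ k))"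

(* Since prodinf is a definite description, it denotes the intended series only if the
   product converges. *)
lemma ternary_product_has_prod:
  "(\<lambda>k. 1 - fps_X ^ (3 ^ k) - fps_X ^ (2 * 3 ^ k) :: int fps) has_prod ternary_product"
proof -
  define f :: "nat \<Rightarrow> int fps" where "f k = 1 - fps_X ^ (3 ^ k) - fps_X ^ (2 * 3 ^ k)" for k
  have f0: "fps_nth (f k) 0 = 1" for k
    by (simp add: f_def)
  hence fnz: "f k \<noteq> 0" for k
    by (metis fps_zero_nth zero_neq_one)
  have sub: "subdegree (f k - 1) > n" if "k > n" for n k
  proof (rule subdegree_greaterI)
    have "k < 3 ^ k"
      by (rule less_exp[THEN less_le_trans]) (simp add: power_mono)
    with that show "fps_nth (f k - 1) i = 0" if "i \<le> n" for i
      using that by (simp add: f_def fps_X_power_nth)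
    have "fps_nth (f k - 1) (3 ^ k) \<noteq> 0"
      by (simp add: f_def fps_X_power_nth)
    thus "f k - 1 \<noteq> 0"
      by (metis fps_zero_nth)
  qed
  obtain P where P: "(\<lambda>n. \<Prod>k\<le>n. f k) \<longlonglongrightarrow> P"
    using tendsto_prod_fps[of f "\<lambda>n. n", OF fnz sub] by blast
  have "fps_nth (\<Prod>k\<le>n. f k) 0 = 1" for n
    by (induction n) (simp_all add: f0)
  hence "fps_nth P 0 = 1"
    using P unfolding tendsto_fps_iff eventually_sequentially by (metis order_refl)
  hence "P \<noteq> 0"
    by auto
  with P have hp: "f has_prod P"
    by (simp add: has_prod_def raw_has_prod_def)
  hence "P = ternary_product"
    using has_prod_unique[OF hp] by (simp add: ternary_product_def f_def[abs_def])
  with hp show ?thesis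
    by (simp add: f_def[abs_def])
qed

end

theory Submission
  imports Defs
begin

text \<open>
  The coefficients \<open>d\<^sub>n\<close> of the product are odd integers, so a linear dependency between the
  columns of its Hankel matrix can be reduced modulo 2 after halving the differences of consecutive
  rows. This gives a dependency modulo 2 for the Hankel matrix of \<open>e\<^sub>n = c\<^sub>n\<^sub>+\<^sub>1 - c\<^sub>n\<close>, where
  \<open>c\<^sub>n = (d\<^sub>n - d\<^sub>n\<^sub>+\<^sub>1) / 2\<close>. The functional equation \<open>f(x) = (1 - x - x\<^sup>2) f(x\<^sup>3)\<close> yields
  \<open>c\<^sub>2\<^sub>n\<^sub>+\<^sub>1 + c\<^sub>n \<equiv> 1\<close>, hence \<open>e\<^sub>2\<^sub>n\<^sub>+\<^sub>2 + e\<^sub>2\<^sub>n\<^sub>+\<^sub>1 + e\<^sub>n \<equiv> 0\<close> and \<open>e\<^sub>0 \<equiv> 1\<close> modulo 2: the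
  recurrence characterising a perfect linear complexity profile over the field with two elements,
  for which every Hankel determinant is odd. So every integer vector in the kernel of the Hankel
  matrix of \<open>f\<close> is even, and by infinite descent it vanishes.
\<close>

section \<open>Kernels of Hankel matrices modulo 2\<close>

text \<open>Off-diagonal terms occur in equal pairs and \<open>v i * v i\<close> has the parity of
  \<open>v i\<close>, so modulo 2 a symmetric quadratic form is linear.\<close>

lemma even_symmetric_form:
  fixes v :: "nat \<Rightarrow> int" and A :: "nat \<Rightarrow> nat \<Rightarrow> int"
  assumes sym: "\<And>i j. A i j = A j i"
  shows "even ((\<Sum>i<n. v i * (\<Sum>j<n. A i j * v j)) - (\<Sum>i<n. A i i * v i))"
proof (induction n)
  case (Suc n)
  have "(\<Sum>i<n. v i * (A i n * v n)) = v n * (\<Sum>j<n. A n j * v j)"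
    by (simp add: sum_distrib_left sym[of _ n] mult_ac)
  then have step: "(\<Sum>i<Suc n. v i * (\<Sum>j<Suc n. A i j * v j)) - (\<Sum>i<Suc n. A i i * v i)
      = ((\<Sum>i<n. v i * (\<Sum>j<n. A i j * v j)) - (\<Sum>i<n. A i i * v i))
        + 2 * (v n * (\<Sum>j<n. A n j * v j)) + A n n * (v n * (v n - 1))"
    by (simp add: distrib_left sum.distrib algebra_simps)
  show ?case
    unfolding step using Suc.IH by simp
qed simp

text \<open>Two symmetric forms evaluated at \<open>v\<close> give linear relations that the
  recurrence combines to force \<open>v 0\<close> even; the shifted vector then lies in the kernel
  of size \<open>m\<close>, and induction applies.\<close>

lemma hankel_kernel_even:
  fixes e v :: "nat \<Rightarrow> int"
  assumes e0: "odd (e 0)"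
    and rec: "\<And>i. even (e (2 * i + 2) + e (2 * i + 1) + e i)"
    and ker: "\<And>i. i < n \<Longrightarrow> even (\<Sum>j<n. e (i + j) * v j)"
    and "j < n"
  shows "even (v j)"
  using ker \<open>j < n\<close>
proof (induction n arbitrary: v j)
  case (Suc m)
  define p where "p = (\<Sum>j<m. e j * v (Suc j))"
  \<comment> \<open>The index is lowered by one: row \<open>Suc i\<close> of \<open>E'\<close> is
    row \<open>i\<close> of the given matrix, and the corner set to 0 replaces the missing
    \<open>e (-1)\<close>.\<close>
  define E' where "E' i j = (if i + j = 0 then 0 else e (i + j - 1))" for i j
  have "even (\<Sum>i<Suc m. v i * (\<Sum>j<Suc m. e (i + j) * v j))"
    using Suc.prems(1) by (intro dvd_sum) simp
  with even_symmetric_form[of "\<lambda>i j. e (i + j)" v "Suc m"]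
  have diag: "even (\<Sum>i<Suc m. e (2 * i) * v i)"
    by (simp add: add.commute mult_2 del: sum.lessThan_Suc)
  have row0: "(\<Sum>j<Suc m. E' 0 j * v j) = p"
    by (simp add: sum.lessThan_Suc_shift E'_def p_def del: sum.lessThan_Suc)
  have "even (\<Sum>i<m. v (Suc i) * (\<Sum>j<Suc m. E' (Suc i) j * v j))"
    using Suc.prems(1) by (intro dvd_sum) (simp add: E'_def del: sum.lessThan_Suc)
  then have "even ((\<Sum>i<Suc m. v i * (\<Sum>j<Suc m. E' i j * v j)) - v 0 * p)"
    by (subst sum.lessThan_Suc_shift) (simp add: row0 del: sum.lessThan_Suc)
  with even_symmetric_form[of E' v "Suc m"]
  have "even ((\<Sum>i<Suc m. E' i i * v i) - v 0 * p)"
    by (simp add: E'_def add.commute del: sum.lessThan_Suc)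
  moreover have "(\<Sum>i<Suc m. E' i i * v i) = (\<Sum>i<m. e (2 * i + 1) * v (Suc i))"
    by (simp add: sum.lessThan_Suc_shift E'_def mult_2 del: sum.lessThan_Suc)
  ultimately have odd_part: "even ((\<Sum>i<m. e (2 * i + 1) * v (Suc i)) - v 0 * p)"
    by (simp del: sum.lessThan_Suc)
  have "even (\<Sum>i<m. (e (2 * i + 2) + e (2 * i + 1) + e i) * v (Suc i))"
    using rec by (intro dvd_sum) simp
  moreover have "(\<Sum>i<m. (e (2 * i + 2) + e (2 * i + 1) + e i) * v (Suc i))
      = (\<Sum>i<Suc m. e (2 * i) * v i) - e 0 * v 0 + (\<Sum>i<m. e (2 * i + 1) * v (Suc i)) + p"
    by (simp add: sum.lessThan_Suc_shift p_def sum.distrib distrib_right del: sum.lessThan_Suc)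
  \<comment> \<open>The expression is \<open>(1 + v 0) * (1 + p) - 1\<close>, which is even only
    when \<open>v 0\<close> and \<open>p\<close> both are.\<close>
  ultimately have "even (v 0 + v 0 * p + p)"
    using diag odd_part e0 by (auto simp del: sum.lessThan_Suc)
  then have v0: "even (v 0)" and p: "even p"
    by auto
  have "even (\<Sum>j<m. e (i + j) * v (Suc j))" if "i < m" for i
  proof (cases i)
    case (Suc k)
    have "even (\<Sum>j<Suc m. e (k + j) * v j)"
      using Suc that by (intro Suc.prems(1)) simp
    then show ?thesis
      using v0 Suc by (simp add: sum.lessThan_Suc_shift del: sum.lessThan_Suc)
  qed (use p in \<open>simp add: p_def\<close>)
  then have "even (v (Suc j))" if "j < m" for j
    using Suc.IH[of "\<lambda>j. v (Suc j)"] that by blast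
  with v0 Suc.prems(2) show ?case
    by (cases j) auto
qed simp

lemma summation_by_parts:
  fixes c v :: "nat \<Rightarrow> int"
  shows "(\<Sum>j<Suc m. c j * v j)
    = c m * (\<Sum>k<Suc m. v k) - (\<Sum>j<m. (c (Suc j) - c j) * (\<Sum>k<Suc j. v k))"
  by (induction m) (simp_all add: algebra_simps)

text \<open>Row differences remove the constant 1 and allow halving; summation by parts then
  replaces \<open>v\<close> by its partial sums \<open>u\<close> and loses one column, so the matrix
  of \<open>e\<close> is again square.\<close>

lemma signed_hankel_kernel_even:
  fixes b v :: "nat \<Rightarrow> int"
  assumes b: "\<And>i. odd (b (2 * i + 1) + b (2 * i + 2) + b i + b (i + 1))"
    and ker: "\<And>i. i < n \<Longrightarrow> (\<Sum>j<n. (1 - 2 * b (i + j)) * v j) = 0"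
    and "j < n"
  shows "even (v j)"
proof -
  obtain m where n: "n = Suc m"
    using \<open>j < n\<close> by (cases n) auto
  define c where "c i = b (i + 1) - b i" for i
  define e where "e i = c (i + 1) - c i" for i
  define u where "u j = (\<Sum>k<Suc j. v k)" for j
  have "(\<Sum>j<n. (1 - 2 * b j) * v j) = u m - 2 * (\<Sum>j<n. b j * v j)"
    by (simp add: u_def n left_diff_distrib sum_subtractf sum_distrib_left mult.assoc
        del: sum.lessThan_Suc)
  with ker[of 0] n have um: "even (u m)"
    by simp
  have "even (\<Sum>j<m. e (i + j) * u j)" if "i < m" for i
  proof -
    have "2 * (\<Sum>j<n. c (i + j) * v j)
        = (\<Sum>j<n. (1 - 2 * b (i + j)) * v j) - (\<Sum>j<n. (1 - 2 * b (Suc i + j)) * v j)"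
      by (simp add: c_def sum_subtractf[symmetric] sum_distrib_left algebra_simps
          del: sum.lessThan_Suc)
    also have "\<dots> = 0"
      using ker[of i] ker[of "Suc i"] that n by simp
    finally have "(\<Sum>j<Suc m. c (i + j) * v j) = 0"
      using n by simp
    then have "(\<Sum>j<m. e (i + j) * u j) = c (i + m) * u m"
      unfolding summation_by_parts[of "\<lambda>j. c (i + j)"] by (simp add: e_def u_def)
    then show ?thesis
      using um by simp
  qed
  moreover have "odd (e 0)"
    using b[of 0] by (simp add: e_def c_def numeral_2_eq_2)
  \<comment> \<open>The sum equals
    \<open>(c (2 * i + 3) + c (i + 1)) - (c (2 * i + 1) + c i)\<close>, and both brackets are odd by
    \<open>b\<close>.\<close>
  moreover have "even (e (2 * i + 2) + e (2 * i + 1) + e i)" for i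
    using b[of i] b[of "i + 1"] by (simp add: e_def c_def eval_nat_numeral) argo
  ultimately have u: "even (u j)" if "j < n" for j
    using hankel_kernel_even[of e m u j] um that n less_Suc_eq by blast
  show ?thesis
  proof (cases j)
    case 0
    then show ?thesis
      using u[of 0] n by (simp add: u_def)
  next
    case (Suc k)
    then have "v j = u j - u k"
      by (simp add: u_def)
    then show ?thesis
      using u[of j] u[of k] Suc \<open>j < n\<close> by simp
  qed
qed

lemma hankel_det_nonzero:
  fixes f :: "int fps" and b :: "nat \<Rightarrow> int"
  assumes f: "\<And>i. fps_nth f i = 1 - 2 * b i"
    and b: "\<And>i. odd (b (2 * i + 1) + b (2 * i + 2) + b i + b (i + 1))"
  shows "hankel_det n f \<noteq> 0"
proof
  assume "hankel_det n f = 0"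
  then obtain w where w: "w \<in> carrier_vec n" "w \<noteq> 0\<^sub>v n"
    and Aw: "mat n n (\<lambda>(i, j). fps_nth f (i + j)) *\<^sub>v w = 0\<^sub>v n"
    unfolding hankel_det_def by (subst (asm) det_0_iff_vec_prod_zero[of _ n]) auto
  have descent: "2 ^ k dvd v j"
    if "\<And>i. i < n \<Longrightarrow> (\<Sum>j<n. (1 - 2 * b (i + j)) * v j) = 0" "j < n"
    for k j and v :: "nat \<Rightarrow> int"
    using that
  proof (induction k arbitrary: v)
    case (Suc k)
    define v' where "v' j = v j div 2" for j
    have v: "v j = 2 * v' j" if "j < n" for j
      using signed_hankel_kernel_even[OF b Suc.prems(1) that] by (simp add: v'_def)
    have double: "2 * (\<Sum>j<n. (1 - 2 * b (i + j)) * v' j) = (\<Sum>j<n. (1 - 2 * b (i + j)) * v j)" for i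
      by (simp add: v sum_distrib_left mult_ac)
    have "(\<Sum>j<n. (1 - 2 * b (i + j)) * v' j) = 0" if "i < n" for i
      using double[of i] Suc.prems(1)[OF that] by linarith
    then have "2 ^ k dvd v' j"
      using Suc.prems(2) by (rule Suc.IH)
    then show ?case
      using v Suc.prems(2) by simp
  qed simp
  have "(\<Sum>j<n. (1 - 2 * b (i + j)) * w $ j) = 0" if "i < n" for i
  proof -
    have "(mat n n (\<lambda>(i, j). fps_nth f (i + j)) *\<^sub>v w) $ i = 0"
      using Aw that by simp
    then show ?thesis
      using that w(1) by (simp add: scalar_prod_def f atLeast0LessThan)
  qed
  then have dvd: "2 ^ k dvd w $ j" if "j < n" for k j
    using descent[of "\<lambda>j. w $ j"] that by blast
  have "w $ j = 0" if "j < n" for j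
  proof (rule ccontr)
    assume "w $ j \<noteq> 0"
    \<comment> \<open>Any exponent \<open>k\<close> with \<open>2 ^ k\<close> above the absolute
      value of the entry would do.\<close>
    with dvd[OF that, of "nat \<bar>w $ j\<bar>"] have "2 ^ nat \<bar>w $ j\<bar> \<le> \<bar>w $ j\<bar>"
      by (metis dvd_imp_le_int abs_numeral power_abs)
    moreover have "int (nat \<bar>w $ j\<bar>) < 2 ^ nat \<bar>w $ j\<bar>"
      by (metis less_exp of_nat_less_iff of_nat_numeral of_nat_power)
    ultimately show False
      by simp
  qed
  with w show False
    by (metis carrier_vecD eq_vecI index_zero_vec)
qed

section \<open>Coefficients of the infinite product\<close>

lemma ternary_product_functional_equation:
  "ternary_product = (1 - fps_X - fps_X ^ 2) * (ternary_product oo fps_X ^ 3)"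
proof -
  define g :: "nat \<Rightarrow> int fps" where "g k = 1 - fps_X ^ (3 ^ k) - fps_X ^ (2 * 3 ^ k)" for k
  define P where "P n = (\<Prod>k<n. g k)" for n
  have X0: "fps_nth (fps_X ^ 3 :: int fps) 0 = 0"
    by simp
  have g_Suc: "g (Suc k) = g k oo fps_X ^ 3" for k
    by (simp add: g_def fps_compose_sub_distrib fps_X_power_compose[OF X0] mult_ac
        flip: power_mult)
  have P_Suc: "P (Suc n) = (1 - fps_X - fps_X ^ 2) * (P n oo fps_X ^ 3)" for n
    unfolding P_def prod.lessThan_Suc_shift fps_compose_prod_distrib[OF X0] g_Suc[symmetric]
    by (simp add: g_def)
  have lim: "P \<longlonglongrightarrow> ternary_product"
    using has_prod_imp_tendsto'[OF ternary_product_has_prod] by (simp add: P_def[abs_def] g_def)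
  show ?thesis
  proof (rule fps_ext)
    fix n
    \<comment> \<open>Coefficient \<open>n\<close> of the right-hand side involves only coefficients
      of index at most \<open>n\<close>, so these must stabilise simultaneously.\<close>
    have "\<forall>\<^sub>F N in sequentially. \<forall>k\<le>n. fps_nth (P N) k = fps_nth ternary_product k"
      using lim unfolding tendsto_fps_iff
      by (simp add: eventually_ball_finite flip: atMost_iff Ball_def)
    moreover have "\<forall>\<^sub>F N in sequentially. fps_nth (P (Suc N)) n = fps_nth ternary_product n"
      using LIMSEQ_Suc[OF lim] by (simp add: tendsto_fps_iff)
    ultimately have "\<forall>\<^sub>F N in sequentially. fps_nth ternary_product n
      = fps_nth ((1 - fps_X - fps_X ^ 2) * (ternary_product oo fps_X ^ 3)) n"
    proof eventually_elim
      case (elim N)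
      then show ?case
        unfolding P_Suc by (auto simp: fps_mult_nth fps_compose_nth intro!: sum.cong)
    qed
    then show "fps_nth ternary_product n
        = fps_nth ((1 - fps_X - fps_X ^ 2) * (ternary_product oo fps_X ^ 3)) n"
      by simp
  qed
qed

lemma fps_nth_compose_X_power3:
  "fps_nth (f oo fps_X ^ 3) n = (if 3 dvd n then fps_nth f (n div 3) else (0 :: int))"
proof -
  have "fps_nth (f oo fps_X ^ 3) n = (\<Sum>i\<le>n. if n = 3 * i then fps_nth f i else 0)"
    unfolding fps_compose_nth power_mult[symmetric] fps_X_power_nth atMost_atLeast0
    by (intro sum.cong) auto
  then show ?thesis
    by (auto simp: dvd_def sum.delta)
qed

text \<open>The series \<open>g\<close> lives on multiples of 3, so in each residue class only one
  of \<open>g\<close>, \<open>fps_X * g\<close> and \<open>fps_X ^ 2 * g\<close>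
  contributes.\<close>

lemma ternary_product_nth:
  "fps_nth ternary_product (3 * m) = fps_nth ternary_product m"
  "fps_nth ternary_product (3 * m + 1) = - fps_nth ternary_product m"
  "fps_nth ternary_product (3 * m + 2) = - fps_nth ternary_product m"
proof -
  define g where "g = (ternary_product oo fps_X ^ 3)"
  have g: "fps_nth g n = (if 3 dvd n then fps_nth ternary_product (n div 3) else 0)" for n
    by (simp add: g_def fps_nth_compose_X_power3)
  have "ternary_product = g - fps_X * g - fps_X ^ 2 * g"
    unfolding g_def by (subst ternary_product_functional_equation) (simp add: left_diff_distrib)
  then have nth: "fps_nth ternary_product n
      = fps_nth g n - fps_nth (fps_X * g) n - fps_nth (fps_X ^ 2 * g) n"
    for n
    by (metis fps_sub_nth)
  \<comment> \<open>For \<open>m = 0\<close> truncated subtraction gives 0, a multiple of 3; hence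
    the separate case below.\<close>
  have "\<not> 3 dvd 3 * m - 1" "\<not> 3 dvd 3 * m - 2" if "m > 0"
    using that by presburger+
  then show "fps_nth ternary_product (3 * m) = fps_nth ternary_product m"
    unfolding nth[of "3 * m"] g fps_X_mult_nth fps_X_power_mult_nth by (cases "m = 0") auto
  have mod1: "\<not> 3 dvd 3 * m + 1" "m > 0 \<Longrightarrow> \<not> 3 dvd 3 * m + 1 - 2"
    and mod2: "\<not> 3 dvd 3 * m + 2" "\<not> 3 dvd 3 * m + 2 - 1"
    by presburger+
  show "fps_nth ternary_product (3 * m + 1) = - fps_nth ternary_product m"
    unfolding nth[of "3 * m + 1"] g fps_X_mult_nth fps_X_power_mult_nth
    using mod1 by (cases "m = 0") auto
  show "fps_nth ternary_product (3 * m + 2) = - fps_nth ternary_product m"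
    unfolding nth[of "3 * m + 2"] g fps_X_mult_nth fps_X_power_mult_nth
    using mod2 by auto
qed

lemma ternary_product_nth_0: "fps_nth ternary_product 0 = 1"
proof -
  have "(\<lambda>n. \<Prod>k<n. 1 - fps_X ^ (3 ^ k) - fps_X ^ (2 * 3 ^ k)) \<longlonglongrightarrow> ternary_product"
    using has_prod_imp_tendsto'[OF ternary_product_has_prod] .
  then have "\<forall>\<^sub>F n in sequentially.
      fps_nth (\<Prod>k<n. 1 - fps_X ^ (3 ^ k) - fps_X ^ (2 * 3 ^ k)) 0 = fps_nth ternary_product 0"
    unfolding tendsto_fps_iff by blast
  moreover have "fps_nth (\<Prod>k<n. 1 - fps_X ^ (3 ^ k) - fps_X ^ (2 * 3 ^ k) :: int fps) 0 = 1" for n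
    by (induction n) simp_all
  ultimately show ?thesis
    by simp
qed

theorem theorem2p7:
  fixes n :: nat
  assumes "n > 0"
  shows "hankel_det n ternary_product \<noteq> 0"
proof -
  define b where "b i = (1 - fps_nth ternary_product i) div 2" for i
  have "odd (fps_nth ternary_product i)" for i
  proof (induction i rule: less_induct)
    case (less i)
    have "i = 3 * (i div 3) \<or> i = 3 * (i div 3) + 1 \<or> i = 3 * (i div 3) + 2"
      by presburger
    then consider "i = 0" | m where "m < i" "i = 3 * m \<or> i = 3 * m + 1 \<or> i = 3 * m + 2"
      by (metis div_less_dividend gr0I numeral_less_iff one_less_numeral_iff semiring_norm(77))
    then show ?case
      using less ternary_product_nth ternary_product_nth_0
      by cases (auto simp del: One_nat_def add_2_eq_Suc')
  qed
  then have f: "fps_nth ternary_product i = 1 - 2 * b i" for i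
    by (simp add: b_def)
  have b3: "b (3 * m) = b m" "b (3 * m + 1) = 1 - b m" "b (3 * m + 2) = 1 - b m" for m
    using ternary_product_nth[of m] by (simp_all add: f)
  \<comment> \<open>Strong induction on base 3 digits: for residues 0 and 1 the terms from
    \<open>b3\<close> cancel modulo 2 to leave 1, while residue 2 reduces to the same claim at
    \<open>m\<close>.\<close>
  have "odd (b (2 * i + 1) + b (2 * i + 2) + b i + b (i + 1))" for i
  proof (induction i rule: less_induct)
    case (less i)
    define m where "m = i div 3"
    consider "i = 3 * m" | "i = 3 * m + 1" | "i = 3 * m + 2"
      unfolding m_def by linarith
    then show ?case
    proof cases
      case 1
      then show ?thesis
        using b3[of "2 * m"] b3[of m] by (simp add: mult.assoc[symmetric])
    next
      case 2
      have "2 * i + 1 = 3 * (2 * m + 1)" "2 * i + 2 = 3 * (2 * m + 1) + 1" "i + 1 = 3 * m + 2"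
        using 2 by simp_all
      then show ?thesis
        using 2 by (simp only: b3) simp
    next
      case 3
      have "2 * i + 1 = 3 * (2 * m + 1) + 2" "2 * i + 2 = 3 * (2 * m + 2)" "i + 1 = 3 * (m + 1)"
        using 3 by simp_all
      then show ?thesis
        using 3 less[of m] by (simp only: b3) (simp, argo)
    qed
  qed
  then show ?thesis
    using hankel_det_nonzero f by blast
qed

end
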